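(* Let $n \ge 1$ be an integer and $I=[0,1]$. For $i=1,\ldots,n$, let $H_i^+, H_i^-\subset I^n$ be closed sets such that for all $i\in\{1,\ldots,n\}$ one has $I_i^-\subset H_i^-$, $I_i^+\subset H_i^+$ and $H_i^-\cup H_i^+=I^n$. Then $\bigcap_{i=1}^n (H_i^-\cap H_i^+)\neq\emptyset$.
   Context: The cube $I^n=[0,1]^n$ carries its usual (Euclidean) topology. Its faces are, for $i\in\{1,\ldots,n\}$, $I_i^-=\{x\in I^n \mid x_i=0\}$ and $I_i^+=\{x\in I^n \mid x_i=1\}$. *)

theory Defs
  imports "HOL-Analysis.Analysis"
begin

text \<open>The coordinates \<open>1, \<dots>, n\<close> are the elements of the finite (hence nonempty) index type
  \<open>'n\<close>, so that \<open>n = CARD('n) \<ge> 1\<close>. The numeral \<open>1\<close> is the all-ones vector.\<close>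

definition unit_cube :: "(real ^ 'n) set"
  where "unit_cube = cbox 0 1"

lemma mem_unit_cube: "x \<in> unit_cube \<longleftrightarrow> (\<forall>i. 0 \<le> x $ i \<and> x $ i \<le> 1)"
  by (simp add: unit_cube_def mem_box_cart)

definition lower_face :: "'n \<Rightarrow> (real ^ 'n) set"
  where "lower_face i = {x \<in> unit_cube. x $ i = 0}"

definition upper_face :: "'n \<Rightarrow> (real ^ 'n) set"
  where "upper_face i = {x \<in> unit_cube. x $ i = 1}"

end

theory Submission
  imports Defs
begin

text \<open>Moving each coordinate towards \<open>Hminus i\<close> by the distance to \<open>Hminus i\<close>, and away from it
  by the distance to \<open>Hplus i\<close>, keeps the cube invariant, since these distances are at most
  those to the two opposite faces and one of them vanishes. At a Brouwer fixed point the two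
  distances agree, so both vanish.\<close>

text \<open>The orthogonal projection of \<open>x\<close> onto the face lies in \<open>S\<close>, at
  distance \<open>x $ i\<close> from \<open>x\<close>. This limits how far coordinate
  \<open>i\<close> can be moved down.\<close>

lemma infdist_le_lower:
  fixes x :: "real ^ 'n::finite"
  assumes "x \<in> unit_cube" "lower_face i \<subseteq> S"
  shows "infdist x S \<le> x $ i"
proof -
  let ?y = "x - axis i (x $ i)"
  have "?y \<in> S"
    using assms by (auto simp: lower_face_def mem_unit_cube axis_def)
  then have "infdist x S \<le> dist x ?y"
    by (rule infdist_le)
  also have "\<dots> = x $ i"
    using assms by (simp add: dist_norm norm_eq_sqrt_inner inner_axis_axis mem_unit_cube)
  finally show ?thesis .
qed

text \<open>Mirror image, projecting onto the opposite face; it limits the move upwards.\<close>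

lemma infdist_le_upper:
  fixes x :: "real ^ 'n::finite"
  assumes "x \<in> unit_cube" "upper_face i \<subseteq> S"
  shows "infdist x S \<le> 1 - x $ i"
proof -
  let ?y = "x + axis i (1 - x $ i)"
  have "?y \<in> S"
    using assms by (auto simp: upper_face_def mem_unit_cube axis_def)
  then have "infdist x S \<le> dist x ?y"
    by (rule infdist_le)
  also have "\<dots> = 1 - x $ i"
    using assms by (simp add: dist_norm norm_eq_sqrt_inner inner_axis_axis mem_unit_cube)
  finally show ?thesis .
qed

theorem theorem3p1:
  fixes Hminus Hplus :: "'n::finite \<Rightarrow> (real ^ 'n) set"
  assumes "\<And>i. closedin (top_of_set unit_cube) (Hminus i)"
    and "\<And>i. closedin (top_of_set unit_cube) (Hplus i)"
    and "\<And>i. lower_face i \<subseteq> Hminus i"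
    and "\<And>i. upper_face i \<subseteq> Hplus i"
    and "\<And>i. Hminus i \<union> Hplus i = unit_cube"
  shows "(\<Inter>i. Hminus i \<inter> Hplus i) \<noteq> {}"
proof -
  define f :: "real ^ 'n \<Rightarrow> real ^ 'n"
    where "f x = (\<chi> i. x $ i - infdist x (Hminus i) + infdist x (Hplus i))" for x
  have closed: "closed (Hminus i)" "closed (Hplus i)" for i
    using assms(1,2) closed_cbox closedin_closed_trans unfolding unit_cube_def by blast+
  \<comment> \<open>\<open>infdist\<close> to the empty set is 0 by convention, so nonemptiness is
    needed to pass from distance 0 to membership. Two opposite corners of the cube serve as
    witnesses for all \<open>i\<close>.\<close>
  have "(0 :: real ^ 'n) \<in> lower_face i" "(1 :: real ^ 'n) \<in> upper_face i" for i
    by (auto simp: lower_face_def upper_face_def mem_unit_cube)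
  then have nonempty: "Hminus i \<noteq> {}" "Hplus i \<noteq> {}" for i
    using assms(3,4) by blast+
  have vanish: "infdist x (Hminus i) = 0 \<or> infdist x (Hplus i) = 0" if "x \<in> unit_cube" for x i
    using that assms(5)[of i] by (metis Un_iff infdist_zero)
  have "f x \<in> unit_cube" if x: "x \<in> unit_cube" for x
    unfolding mem_unit_cube
  proof
    fix i
    \<comment> \<open>If the distance to \<open>Hminus i\<close> is 0, the coordinate can only rise,
      by at most \<open>1 - x $ i\<close>; otherwise it only falls, by at most
      \<open>x $ i\<close>.\<close>
    show "0 \<le> f x $ i \<and> f x $ i \<le> 1"
      using vanish[OF x, of i] infdist_le_lower[OF x assms(3)[of i]]
        infdist_le_upper[OF x assms(4)[of i]]
        infdist_nonneg[of x "Hminus i"] infdist_nonneg[of x "Hplus i"]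
      by (auto simp: f_def)
  qed
  then have "f \<in> unit_cube \<rightarrow> unit_cube"
    by blast
  moreover have "continuous_on unit_cube f"
    unfolding f_def by (intro continuous_intros)
  moreover have "compact (unit_cube :: (real ^ 'n) set)" "convex (unit_cube :: (real ^ 'n) set)"
    by (simp_all add: unit_cube_def)
  moreover have "unit_cube \<noteq> ({} :: (real ^ 'n) set)"
    using nonempty assms(5) by blast
  ultimately obtain x where x: "x \<in> unit_cube" "f x = x"
    using brouwer by metis
  have "x \<in> Hminus i \<inter> Hplus i" for i
  proof -
    have "infdist x (Hminus i) = infdist x (Hplus i)"
      using arg_cong[OF x(2), of "\<lambda>v. v $ i"] by (simp add: f_def)
    \<comment> \<open>One of the two equal distances is 0, hence both are; closedness turns this
      into membership.\<close>
    then show ?thesis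
      using vanish[OF x(1), of i] in_closed_iff_infdist_zero closed nonempty by (metis IntI)
  qed
  then show ?thesis
    by blast
qed

end
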